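(* Let $\beta > \frac{81}{16}$ be a constant. Then, as $n\to\infty$ and uniformly in the number of steps $t\in\mathbb{Z}_{\ge 0}$, $$\left|\langle \psi_{[n]}|\,\mathcal{W}^t\,|\psi_{e}\rangle\right|^2 = O\!\left(\frac{n^{20}\beta^{2n}}{n!}\right),$$ i.e. there is a constant $C$ depending only on $\beta$ such that the left-hand side is at most $C\,n^{20}\beta^{2n}/n!$ for all $n\ge 2$ and all integers $t\ge 0$. Here $\mathcal{W}$ is the Szegedy quantum walk operator on $\mathbb{C}[\mathcal{S}_n]\otimes\mathbb{C}[\mathcal{S}_n]$ associated with the uniform random walk on $\mathcal{S}_n$ generated by all transpositions, and $$|\psi_{[n]}\rangle = \frac{1}{\sqrt{(n-1)!\,d}}\sum_{g \in [n],\, s \in S}|g, gs\rangle,\qquad |\psi_{e}\rangle = \frac{1}{\sqrt{d}}\sum_{s \in S}|e, s\rangle .$$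
   Context: $\mathcal{S}_n$ is the symmetric group on $n$ letters, $e$ its identity, $S\subset\mathcal{S}_n$ the set of all transpositions, $d=|S|=\binom n2$, and $[n]$ denotes the set (conjugacy class) of all $n$-cycles in $\mathcal{S}_n$. The Hilbert space $\mathbb{C}[\mathcal{S}_n]\otimes\mathbb{C}[\mathcal{S}_n]$ has orthonormal basis $|g,h\rangle$, $g,h\in\mathcal{S}_n$; $\mathbb{C}[\mathcal{S}_n]$ has orthonormal basis $|g\rangle$. Szegedy walk: for $g\in\mathcal{S}_n$ put $|\phi_g\rangle=\frac1{\sqrt d}\sum_{s\in S}|g,gs\rangle$ and $|\phi'_g\rangle=\frac1{\sqrt d}\sum_{s\in S}|gs^{-1},g\rangle$. Let $A=\sum_{g}|\phi_g\rangle\langle g|$ and $B=\sum_g|\phi'_g\rangle\langle g|$ (linear maps $\mathbb{C}[\mathcal{S}_n]\to\mathbb{C}[\mathcal{S}_n]\otimes\mathbb{C}[\mathcal{S}_n]$), $R_A=2AA^\dagger-I$, $R_B=2BB^\dagger-I$, and $\mathcal{W}=R_BR_A$. *)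

theory Defs
  imports Complex_Main "HOL-Algebra.Sym_Groups"
begin

type_synonym perm = "nat \<Rightarrow> nat"

definition transpositions :: "nat \<Rightarrow> perm set" where
  "transpositions n =
     {Transposition.transpose a b | a b. a \<in> {1..n} \<and> b \<in> {1..n} \<and> a \<noteq> b}"

definition n_cycles :: "nat \<Rightarrow> perm set" where
  "n_cycles n = {cycle_of_list cs | cs. cycle cs \<and> set cs = {1..n}}"

text \<open>
  The Hilbert space with orthonormal basis a finite set \<open>X\<close> is represented by coefficient
  functions, of which only the values on \<open>X\<close> matter; a linear map from the space over \<open>Y\<close>
  to the space over \<open>X\<close> is represented by its matrix entries \<open>M x y\<close> with
  \<open>x \<in> X\<close>, \<open>y \<in> Y\<close>. The dimension depends on \<open>n\<close>, so the index sets are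
  explicit arguments of every operation that sums over a basis.
\<close>

type_synonym 'a vect = "'a \<Rightarrow> complex"
type_synonym ('a, 'b) op = "'a \<Rightarrow> 'b \<Rightarrow> complex"

definition ket :: "'a \<Rightarrow> 'a vect" where
  "ket a = (\<lambda>x. if x = a then 1 else 0)"

definition ketbra :: "'a vect \<Rightarrow> 'b vect \<Rightarrow> ('a, 'b) op" where
  "ketbra u v = (\<lambda>x y. u x * cnj (v y))"

definition op_one :: "('a, 'a) op" where
  "op_one = (\<lambda>x y. if x = y then 1 else 0)"

definition op_adj :: "('a, 'b) op \<Rightarrow> ('b, 'a) op" where
  "op_adj M = (\<lambda>y x. cnj (M x y))"

definition op_mult :: "'b set \<Rightarrow> ('a, 'b) op \<Rightarrow> ('b, 'c) op \<Rightarrow> ('a, 'c) op" where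
  "op_mult Y M N = (\<lambda>x z. \<Sum>y\<in>Y. M x y * N y z)"

primrec op_pow :: "'a set \<Rightarrow> ('a, 'a) op \<Rightarrow> nat \<Rightarrow> ('a, 'a) op" where
  "op_pow X M 0 = op_one"
| "op_pow X M (Suc t) = op_mult X M (op_pow X M t)"

definition sandwich :: "'a set \<Rightarrow> 'a vect \<Rightarrow> ('a, 'a) op \<Rightarrow> 'a vect \<Rightarrow> complex" where
  "sandwich X u M v = (\<Sum>x\<in>X. \<Sum>y\<in>X. cnj (u x) * M x y * v y)"

text \<open>The reflection \<open>2 M M\<^sup>\<dagger> - I\<close>, where \<open>M\<close> has domain indexed by \<open>Y\<close>.\<close>

definition reflection :: "'b set \<Rightarrow> ('a, 'b) op \<Rightarrow> ('a, 'a) op" where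
  "reflection Y M = (\<lambda>x x'. 2 * op_mult Y M (op_adj M) x x' - op_one x x')"

abbreviation verts :: "nat \<Rightarrow> perm set" where
  "verts n \<equiv> carrier (sym_group n)"

abbreviation arcs :: "nat \<Rightarrow> (perm \<times> perm) set" where
  "arcs n \<equiv> verts n \<times> verts n"

definition phi :: "nat \<Rightarrow> perm \<Rightarrow> (perm \<times> perm) vect" where
  "phi n g = (\<lambda>x. complex_of_real (1 / sqrt (real (card (transpositions n)))) *
     (\<Sum>s\<in>transpositions n. ket (g, g \<otimes>\<^bsub>sym_group n\<^esub> s) x))"

definition phi' :: "nat \<Rightarrow> perm \<Rightarrow> (perm \<times> perm) vect" where
  "phi' n g = (\<lambda>x. complex_of_real (1 / sqrt (real (card (transpositions n)))) *
     (\<Sum>s\<in>transpositions n. ket (g \<otimes>\<^bsub>sym_group n\<^esub> inv\<^bsub>sym_group n\<^esub> s, g) x))"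

definition op_A :: "nat \<Rightarrow> (perm \<times> perm, perm) op" where
  "op_A n = (\<lambda>x y. \<Sum>g\<in>verts n. ketbra (phi n g) (ket g) x y)"

definition op_B :: "nat \<Rightarrow> (perm \<times> perm, perm) op" where
  "op_B n = (\<lambda>x y. \<Sum>g\<in>verts n. ketbra (phi' n g) (ket g) x y)"

definition szegedy_walk :: "nat \<Rightarrow> (perm \<times> perm, perm \<times> perm) op" where
  "szegedy_walk n =
     op_mult (arcs n) (reflection (verts n) (op_B n)) (reflection (verts n) (op_A n))"

definition psi_id :: "nat \<Rightarrow> (perm \<times> perm) vect" where
  "psi_id n = (\<lambda>x. complex_of_real (1 / sqrt (real (card (transpositions n)))) *
     (\<Sum>s\<in>transpositions n. ket (\<one>\<^bsub>sym_group n\<^esub>, s) x))"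

definition psi_cycles :: "nat \<Rightarrow> (perm \<times> perm) vect" where
  "psi_cycles n =
     (\<lambda>x. complex_of_real (1 / sqrt (fact (n - 1) * real (card (transpositions n)))) *
       (\<Sum>g\<in>n_cycles n. \<Sum>s\<in>transpositions n. ket (g, g \<otimes>\<^bsub>sym_group n\<^esub> s) x))"

end

theory Submission
  imports Defs "HOL-Computational_Algebra.Polynomial"
begin

text \<open>
  Let \<open>P\<^sub>g\<close> be the permutation matrix of \<open>g\<close>. The polynomial
  \<open>\<Gamma>\<^sub>g = det (x I - P\<^sub>g) / (x - 1)\<close> is, up to signs, the generating function of the hook
  characters of \<open>g\<close>. Multiplying \<open>g\<close> by a transposition modifies two columns of
  \<open>x I - P\<^sub>g\<close>; summing over all transpositions with Cramer's rule and Jacobi's formula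
  gives \<open>\<Sum>\<^sub>s \<Gamma>\<^bsub>gs\<^esub> = n x \<Gamma>\<^sub>g' - d \<Gamma>\<^sub>g\<close>. So the coefficient of \<open>x ^ k\<close>,
  as a function \<open>v\<^sub>k\<close> of \<open>g\<close>, is an eigenfunction of the random walk with eigenvalue
  \<open>r = (n k - d) / d \<in> [-1, 1]\<close>. As \<open>\<Gamma>\<^sub>g\<close> takes the value \<open>n\<close> at \<open>x = 1\<close> if \<open>g\<close> is an
  \<open>n\<close>-cycle and \<open>0\<close> otherwise, the functions \<open>v\<^sub>k / n\<close> sum to the indicator function of
  the \<open>n\<close>-cycles.

  The walk preserves the span of \<open>A v\<^sub>k\<close> and \<open>B v\<^sub>k\<close>, and unitarity bounds the
  contribution of \<open>v\<^sub>k\<close> to the amplitude by a multiple of \<open>\<bar>v\<^sub>k(e)\<bar>\<close>, uniformly in the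
  number of steps. Since \<open>\<Gamma>\<^sub>e = (x - 1) ^ (n - 1)\<close>, these values add up to
  \<open>2 ^ (n - 1)\<close>, so the squared amplitude is at most \<open>4 ^ (n - 1) / (n * n!)\<close>, well below
  the claimed bound.
\<close>

section \<open>Determinants over a finite index set\<close>

text \<open>\<open>M j\<close> is the \<open>j\<close>-th column, so that \<open>M(a := w)\<close> replaces column \<open>a\<close> by \<open>w\<close>.\<close>

definition det_on :: "'i set \<Rightarrow> ('i \<Rightarrow> 'i \<Rightarrow> 'a::comm_ring_1) \<Rightarrow> 'a" where
  "det_on I M = (\<Sum>p | p permutes I. of_int (sign p) * (\<Prod>j\<in>I. M j (p j)))"

lemma det_on_cong:
  assumes "\<And>i j. i \<in> I \<Longrightarrow> j \<in> I \<Longrightarrow> M j i = N j i"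
  shows "det_on I M = det_on I N"
  unfolding det_on_def
  by (intro sum.cong prod.cong arg_cong2[where f = "(*)"] refl) (auto simp: assms permutes_in_image)

text \<open>The factor next to \<open>w (p a)\<close> does not see column \<open>a\<close>, so
  linearity in that column can be read off. The rules for replaced columns that follow rest on this
  form.\<close>

lemma det_on_upd:
  assumes "finite I" "a \<in> I"
  shows "det_on I (M(a := w)) =
    (\<Sum>p | p permutes I. w (p a) * (of_int (sign p) * (\<Prod>j\<in>I - {a}. M j (p j))))"
  unfolding det_on_def
proof (intro sum.cong refl)
  fix p
  have "(\<Prod>j\<in>I. (M(a := w)) j (p j)) = w (p a) * (\<Prod>j\<in>I - {a}. (M(a := w)) j (p j))"
    using assms by (simp add: prod.remove[of I a])
  also have "(\<Prod>j\<in>I - {a}. (M(a := w)) j (p j)) = (\<Prod>j\<in>I - {a}. M j (p j))"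
    by (intro prod.cong) auto
  finally show "of_int (sign p) * (\<Prod>j\<in>I. (M(a := w)) j (p j)) =
      w (p a) * (of_int (sign p) * (\<Prod>j\<in>I - {a}. M j (p j)))"
    by (simp add: algebra_simps)
qed

lemma det_on_upd_sum:
  assumes "finite I" "a \<in> I"
  shows "det_on I (M(a := \<lambda>i. \<Sum>k\<in>K. c k * w k i)) = (\<Sum>k\<in>K. c k * det_on I (M(a := w k)))"
  unfolding det_on_upd[OF assms]
  by (simp add: sum_distrib_left sum_distrib_right mult.assoc) (rule sum.swap)

lemma det_on_upd_sum1:
  assumes "finite I" "a \<in> I"
  shows "det_on I (M(a := \<lambda>i. \<Sum>k\<in>K. w k i)) = (\<Sum>k\<in>K. det_on I (M(a := w k)))"
  using det_on_upd_sum[OF assms, of M "\<lambda>_. 1" w K] by simp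

lemma det_on_upd_add:
  assumes "finite I" "a \<in> I"
  shows "det_on I (M(a := \<lambda>i. u i + w i)) = det_on I (M(a := u)) + det_on I (M(a := w))"
  unfolding det_on_upd[OF assms] by (simp add: algebra_simps sum.distrib)

lemma det_on_upd_diff:
  assumes "finite I" "a \<in> I"
  shows "det_on I (M(a := \<lambda>i. u i - w i)) = det_on I (M(a := u)) - det_on I (M(a := w))"
  unfolding det_on_upd[OF assms] by (simp add: algebra_simps sum_subtractf)

lemma det_on_upd_scale:
  assumes "finite I" "a \<in> I"
  shows "det_on I (M(a := \<lambda>i. c * w i)) = c * det_on I (M(a := w))"
  unfolding det_on_upd[OF assms] by (simp add: algebra_simps sum_distrib_left)

text \<open>Precomposing \<open>p\<close> with the transposition of \<open>a\<close> and
  \<open>b\<close> flips the sign and, the two columns being equal, keeps the product. So the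
  determinant is its own negative, and characteristic zero makes it vanish.\<close>

lemma det_on_identical_columns:
  fixes M :: "'i \<Rightarrow> 'i \<Rightarrow> 'a::{idom, ring_char_0}"
  assumes "finite I" "a \<in> I" "b \<in> I" "a \<noteq> b" "M a = M b"
  shows "det_on I M = 0"
proof -
  let ?t = "Transposition.transpose a b"
  have t: "?t permutes I" using assms by (simp add: permutes_swap_id)
  have "det_on I M = (\<Sum>p | p permutes I. of_int (sign (p \<circ> ?t)) * (\<Prod>j\<in>I. M j ((p \<circ> ?t) j)))"
    unfolding det_on_def by (rule sum_permutations_compose_right[OF t])
  also have "\<dots> = (\<Sum>p | p permutes I. - (of_int (sign p) * (\<Prod>j\<in>I. M j (p j))))"
  proof (intro sum.cong refl)
    fix p assume "p \<in> {p. p permutes I}"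
    then have "permutation p" using assms(1) by (auto simp: permutation_permutes)
    then have s: "sign (p \<circ> ?t) = - sign p"
      using assms(4) by (simp add: sign_compose permutation_swap_id sign_swap_id)
    have "(\<Prod>j\<in>I. M j ((p \<circ> ?t) j)) = (\<Prod>j\<in>I. M (?t j) (p (?t j)))"
      by (intro prod.cong refl) (auto simp: Transposition.transpose_def assms(5))
    also have "\<dots> = (\<Prod>j\<in>I. M j (p j))"
      using prod.permute[OF t, of "\<lambda>j. M j (p j)"] by (simp add: o_def)
    finally show "of_int (sign (p \<circ> ?t)) * (\<Prod>j\<in>I. M j ((p \<circ> ?t) j)) =
        - (of_int (sign p) * (\<Prod>j\<in>I. M j (p j)))"
      by (simp add: s)
  qed
  also have "\<dots> = - det_on I M" by (simp add: det_on_def sum_negf)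
  finally have "2 * det_on I M = 0" by simp
  then show ?thesis by simp
qed

lemma det_on_upd_column:
  fixes M :: "'i \<Rightarrow> 'i \<Rightarrow> 'a::{idom, ring_char_0}"
  assumes "finite I" "a \<in> I" "b \<in> I"
  shows "det_on I (M(a := M b)) = (if b = a then det_on I M else 0)"
  using det_on_identical_columns[of I a b "M(a := M b)"] assms by auto

text \<open>Adding the other columns of \<open>U\<close> to one of them keeps the determinant, yet
  makes that column zero on the rows in \<open>I\<close>.\<close>

lemma det_on_dependent_columns:
  fixes M :: "'i \<Rightarrow> 'i \<Rightarrow> 'a::{idom, ring_char_0}"
  assumes "finite I" "U \<subseteq> I" "U \<noteq> {}" "\<And>i. i \<in> I \<Longrightarrow> (\<Sum>j\<in>U. M j i) = 0"
  shows "det_on I M = 0"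
proof -
  from assms obtain u where u: "u \<in> U" "u \<in> I" by auto
  have "finite U" using assms finite_subset by auto
  have "det_on I M = (\<Sum>j\<in>U. if j = u then det_on I M else 0)"
    using \<open>finite U\<close> u by simp
  also have "\<dots> = (\<Sum>j\<in>U. det_on I (M(u := M j)))"
    using assms u by (intro sum.cong refl) (subst det_on_upd_column, auto)
  also have "\<dots> = det_on I (M(u := \<lambda>i. \<Sum>j\<in>U. M j i))"
    using assms u by (simp add: det_on_upd_sum1)
  also have "\<dots> = det_on I (M(u := \<lambda>i. 0 * M u i))"
    using assms by (intro det_on_cong) auto
  also have "\<dots> = 0" using assms(1) u by (simp only: det_on_upd_scale) simp
  finally show ?thesis .
qed

text \<open>Expanding in both columns gives two first-order terms and a second-order one; the latter
  has proportional columns \<open>w\<close> and \<open>- w\<close> and vanishes.\<close>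

lemma det_on_add_sub_columns:
  fixes M :: "'i \<Rightarrow> 'i \<Rightarrow> 'a::{idom, ring_char_0}"
  assumes "finite I" "a \<in> I" "b \<in> I" "a \<noteq> b"
  shows "det_on I (M(a := \<lambda>i. M a i + w i, b := \<lambda>i. M b i - w i)) =
    det_on I M + det_on I (M(a := w)) - det_on I (M(b := w))"
proof -
  have "det_on I (M(a := w, b := w)) = 0"
    using assms by (intro det_on_identical_columns[of _ a b]) auto
  moreover have "det_on I (M(a := \<lambda>i. M a i + w i, b := v)) = 
     det_on I (M(b := v)) + det_on I (M(a := w, b := v))" for v
    using det_on_upd_add[OF assms(1,2), of "M(b := v)" "M a" w] assms(4)
    by (simp add: fun_upd_twist[OF assms(4)]) (simp add: fun_upd_idem)
  moreover from this[of "M b"] have "det_on I (M(a := \<lambda>i. M a i + w i, b := M b)) = 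
     det_on I M + det_on I (M(a := w))"
    using assms(4) by (simp add: fun_upd_idem)
  ultimately show ?thesis
    by (simp add: det_on_upd_diff[OF assms(1,3)])
qed

lemma poly_det_on: "poly (det_on I M) x = det_on I (\<lambda>j i. poly (M j i) x)"
  by (simp add: det_on_def poly_sum poly_prod of_int_poly)

text \<open>The product rule in each Leibniz term; by \<open>det_on_upd\<close>, the terms that
  differentiate column \<open>a\<close> regroup into one determinant.\<close>

lemma pderiv_det_on:
  fixes M :: "'i \<Rightarrow> 'i \<Rightarrow> real poly"
  assumes "finite I"
  shows "pderiv (det_on I M) = (\<Sum>a\<in>I. det_on I (M(a := \<lambda>i. pderiv (M a i))))"
proof -
  have sum: "pderiv (sum f A) = (\<Sum>x\<in>A. pderiv (f x))" for f :: "('i \<Rightarrow> 'i) \<Rightarrow> real poly" and A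
    using higher_pderiv_sum[of 1 f A] by simp
  have of_int: "pderiv (of_int z * q) = of_int z * pderiv q" for z and q :: "real poly"
    by (simp add: of_int_poly pderiv_smult)
  have "pderiv (det_on I M) = (\<Sum>p | p permutes I. \<Sum>a\<in>I.
      pderiv (M a (p a)) * (of_int (sign p) * (\<Prod>j\<in>I - {a}. M j (p j))))"
    by (simp add: det_on_def sum of_int pderiv_prod sum_distrib_left ac_simps)
  also have "\<dots> = (\<Sum>a\<in>I. det_on I (M(a := \<lambda>i. pderiv (M a i))))"
    by (subst sum.swap) (simp add: det_on_upd assms)
  finally show ?thesis .
qed

lemma det_on_eq_prod_diag:
  fixes M :: "'i \<Rightarrow> 'i \<Rightarrow> 'a::idom"
  assumes "finite I"
    and "\<And>p. p permutes I \<Longrightarrow> (\<And>j. j \<in> I \<Longrightarrow> M j (p j) \<noteq> 0) \<Longrightarrow> p = id"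
  shows "det_on I M = (\<Prod>j\<in>I. M j j)"
proof -
  have "det_on I M = (\<Sum>p\<in>{id}. of_int (sign p) * (\<Prod>j\<in>I. M j (p j)))"
    unfolding det_on_def
  proof (intro sum.mono_neutral_right finite_permutations assms(1) ballI)
    fix p assume "p \<in> {p. p permutes I} - {id}"
    then obtain j where "j \<in> I" "M j (p j) = 0" using assms(2)[of p] by auto
    then show "of_int (sign p) * (\<Prod>j\<in>I. M j (p j)) = 0"
      using assms(1) by (auto intro: prod_zero)
  qed (auto simp: permutes_id)
  then show ?thesis by simp
qed

section \<open>Characteristic polynomials of permutation matrices\<close>

definition unit_col :: "'i \<Rightarrow> 'i \<Rightarrow> 'a::zero_neq_one" where
  "unit_col k i = (if i = k then 1 else 0)"

text \<open>\<open>[:0, 1:]\<close> is the variable x; column \<open>j\<close> of the permutation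
  matrix has its 1 in row \<open>g j\<close>.\<close>

definition char_cols :: "('i \<Rightarrow> 'i) \<Rightarrow> 'i \<Rightarrow> 'i \<Rightarrow> real poly" where
  "char_cols g j i = [:0, 1:] * unit_col j i - unit_col (g j) i"

definition perm_char_poly :: "'i set \<Rightarrow> ('i \<Rightarrow> 'i) \<Rightarrow> real poly" where
  "perm_char_poly I g = det_on I (char_cols g)"

text \<open>The quotient of \<open>perm_char_poly\<close> by x - 1 without polynomial division: a
  column of ones is what remains of the sum of all columns after x - 1 is taken out. For a
  permutation of \<open>I\<close> the choice of \<open>a\<close> does not matter
  (\<open>hook_poly_base_point\<close>).\<close>

definition hook_poly :: "'i set \<Rightarrow> 'i \<Rightarrow> ('i \<Rightarrow> 'i) \<Rightarrow> real poly" where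
  "hook_poly I a g = det_on I ((char_cols g)(a := \<lambda>_. 1))"

lemma det_on_upd_one:
  assumes "finite I" "a \<in> I"
  shows "det_on I (M(a := \<lambda>_. 1)) = (\<Sum>k\<in>I. det_on I (M(a := unit_col k)))"
proof -
  have "(\<Sum>k\<in>I. det_on I (M(a := unit_col k))) = det_on I (M(a := \<lambda>i. \<Sum>k\<in>I. unit_col k i))"
    using assms by (simp add: det_on_upd_sum1)
  also have "\<dots> = det_on I (M(a := \<lambda>_. 1))"
    by (intro det_on_cong) (auto simp: unit_col_def assms)
  finally show ?thesis by simp
qed

lemma sum_unit_col_permutes:
  assumes "finite I" "g permutes I" "i \<in> I"
  shows "(\<Sum>j\<in>I. unit_col (g j) i) = (1::'a::comm_ring_1)"
proof -
  have "(\<Sum>j\<in>I. unit_col (g j) i) = (\<Sum>j\<in>I. unit_col j i :: 'a)"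
    using sum.permute[OF assms(2), of "\<lambda>j. unit_col j i :: 'a"] by (simp add: o_def)
  then show ?thesis using assms by (simp add: unit_col_def)
qed

text \<open>Add all other columns to column \<open>a\<close>: each row of a permutation matrix sums
  to 1, so every entry of the new column is x - 1, which factors out.\<close>

lemma perm_char_poly_eq_hook_poly:
  assumes "finite I" "a \<in> I" "g permutes I"
  shows "perm_char_poly I g = [:-1, 1:] * hook_poly I a g"
proof -
  have "perm_char_poly I g = (\<Sum>j\<in>I. if j = a then perm_char_poly I g else 0)"
    using assms by simp
  also have "\<dots> = (\<Sum>j\<in>I. det_on I ((char_cols g)(a := char_cols g j)))"
    using assms by (intro sum.cong refl) (subst det_on_upd_column, auto simp: perm_char_poly_def)
  also have "\<dots> = det_on I ((char_cols g)(a := \<lambda>i. \<Sum>j\<in>I. char_cols g j i))"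
    using assms by (simp add: det_on_upd_sum1)
  also have "\<dots> = det_on I ((char_cols g)(a := \<lambda>i. [:-1, 1:] * 1))"
  proof (intro det_on_cong)
    fix i j assume "i \<in> I" "j \<in> I"
    have "(\<Sum>j\<in>I. char_cols g j i) = [:0, 1:] * (\<Sum>j\<in>I. unit_col j i) - (\<Sum>j\<in>I. unit_col (g j) i)"
      by (simp only: char_cols_def sum_subtractf sum_distrib_left)
    also have "\<dots> = [:-1, 1:] * 1"
      using \<open>i \<in> I\<close> assms by (simp add: sum_unit_col_permutes) (simp add: unit_col_def one_pCons)
    finally show "((char_cols g)(a := \<lambda>i. \<Sum>j\<in>I. char_cols g j i)) j i =
        ((char_cols g)(a := \<lambda>i. [:-1, 1:] * 1)) j i" by simp
  qed
  also have "\<dots> = [:-1, 1:] * hook_poly I a g"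
    using assms by (simp only: det_on_upd_scale hook_poly_def)
  finally show ?thesis .
qed

lemma hook_poly_base_point:
  assumes "finite I" "a \<in> I" "b \<in> I" "g permutes I"
  shows "hook_poly I a g = hook_poly I b g"
  using perm_char_poly_eq_hook_poly[OF assms(1,2,4)] perm_char_poly_eq_hook_poly[OF assms(1,3,4)]
  by (metis mult_cancel_left one_pCons pCons_eq_0_iff zero_neq_one)

section \<open>Averaging over transpositions\<close>

text \<open>\<open>C k j\<close> is the cofactor at row \<open>k\<close>, column \<open>j\<close>.
  The transposition exchanges the images of \<open>a\<close> and \<open>b\<close>, so column
  \<open>a\<close> gains \<open>unit_col (g a) - unit_col (g b)\<close> and column \<open>b\<close>
  loses it.\<close>

lemma perm_char_poly_transpose:
  fixes g :: "'i \<Rightarrow> 'i"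
  assumes "finite I" "a \<in> I" "b \<in> I"
  defines "C \<equiv> \<lambda>k j. det_on I ((char_cols g)(j := unit_col k))"
  shows "perm_char_poly I (g \<circ> Transposition.transpose a b) =
    perm_char_poly I g + C (g a) a - C (g b) a - C (g a) b + C (g b) b"
proof (cases "a = b")
  case False
  let ?w = "\<lambda>i. unit_col (g a) i - unit_col (g b) i"
  have "char_cols (g \<circ> Transposition.transpose a b) = (char_cols g)
     (a := \<lambda>i. char_cols g a i + ?w i, b := \<lambda>i. char_cols g b i - ?w i)"
    using False by (auto simp: fun_eq_iff char_cols_def Transposition.transpose_def)
  then have "perm_char_poly I (g \<circ> Transposition.transpose a b) = perm_char_poly I g 
     + det_on I ((char_cols g)(a := ?w)) - det_on I ((char_cols g)(b := ?w))"
    using det_on_add_sub_columns[OF assms(1-3) False, of "char_cols g" ?w]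
    by (simp only: perm_char_poly_def)
  then show ?thesis using assms by (simp add: det_on_upd_diff C_def)
qed (simp add: C_def)

text \<open>Splitting column \<open>a\<close> into its two unit columns expresses the cofactor at
  \<open>(g a, a)\<close> by the one at \<open>(a, a)\<close>. The latter add up to the derivative,
  since column \<open>a\<close> has derivative \<open>unit_col a\<close>.\<close>

lemma sum_cofactors_perm_char_poly:
  assumes "finite I" "g permutes I"
  shows "(\<Sum>a\<in>I. det_on I ((char_cols g)(a := unit_col (g a)))) =
    [:0, 1:] * pderiv (perm_char_poly I g) - of_nat (card I) * perm_char_poly I g"
proof -
  let ?C = "\<lambda>k j. det_on I ((char_cols g)(j := unit_col k))"
  have d: "(\<lambda>i. pderiv (char_cols g a i)) = unit_col a" for a
    by (auto simp: fun_eq_iff char_cols_def unit_col_def pderiv_diff pderiv_pCons)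
  have "?C (g a) a = [:0, 1:] * ?C a a - perm_char_poly I g" if "a \<in> I" for a
  proof -
    have "perm_char_poly I g = det_on I ((char_cols g)(a := 
        \<lambda>i. ([:0, 1:] * unit_col a i) - unit_col (g a) i))"
      unfolding perm_char_poly_def by (intro det_on_cong) (auto simp: char_cols_def)
    also have "\<dots> = [:0, 1:] * ?C a a - ?C (g a) a"
      using assms that by (simp only: det_on_upd_diff det_on_upd_scale)
    finally show ?thesis by (simp add: algebra_simps)
  qed
  then have "(\<Sum>a\<in>I. ?C (g a) a) = [:0, 1:] * (\<Sum>a\<in>I. ?C a a) - of_nat (card I) * perm_char_poly I g"
    by (simp add: sum_subtractf sum_distrib_left)
  also have "(\<Sum>a\<in>I. ?C a a) = pderiv (perm_char_poly I g)"
    unfolding perm_char_poly_def by (subst pderiv_det_on[OF assms(1)]) (simp add: d)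
  finally show ?thesis .
qed

text \<open>With \<open>a\<close> fixed, the mixed cofactors at \<open>(g b, a)\<close> run through
  a whole column because \<open>g\<close> permutes the rows, so they add up to
  \<open>hook_poly\<close>. Equal pairs \<open>a = b\<close> are kept here and removed in
  \<open>sum_transpose_pairs\<close>.\<close>

lemma sum_perm_char_poly_transpose:
  fixes g :: "'i \<Rightarrow> 'i"
  assumes "finite I" "c \<in> I" "g permutes I"
  defines "N \<equiv> of_nat (card I)"
  shows "(\<Sum>a\<in>I. \<Sum>b\<in>I. perm_char_poly I (g \<circ> Transposition.transpose a b)) =
     2 * N * ([:0, 1:] * pderiv (perm_char_poly I g)) - N * N * perm_char_poly I g - 2 * N * hook_poly I c g"
proof -
  let ?C = "\<lambda>k j. det_on I ((char_cols g)(j := unit_col k))"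
  let ?D = "\<Sum>a\<in>I. ?C (g a) a" and ?P = "perm_char_poly I g"
  have H: "(\<Sum>b\<in>I. ?C (g b) a) = hook_poly I c g" if "a \<in> I" for a
  proof -
    have "(\<Sum>b\<in>I. ?C (g b) a) = (\<Sum>b\<in>I. ?C b a)"
      using sum.permute[OF assms(3), of "\<lambda>k. ?C k a"] by (simp add: o_def)
    also have "\<dots> = hook_poly I a g"
      using assms that by (simp add: hook_poly_def det_on_upd_one)
    finally show ?thesis using hook_poly_base_point[OF assms(1) that assms(2,3)] by simp
  qed
  have "(\<Sum>a\<in>I. \<Sum>b\<in>I. perm_char_poly I (g \<circ> Transposition.transpose a b)) =
     (\<Sum>a\<in>I. \<Sum>b\<in>I. ?P + ?C (g a) a - ?C (g b) a - ?C (g a) b + ?C (g b) b)"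
    by (intro sum.cong refl perm_char_poly_transpose assms)
  also have "\<dots> = N * (N * ?P) + N * ?D - (\<Sum>a\<in>I. \<Sum>b\<in>I. ?C (g b) a)
     - (\<Sum>b\<in>I. \<Sum>a\<in>I. ?C (g a) b) + N * ?D"
    by (simp add: sum.distrib sum_subtractf N_def sum_distrib_left distrib_left flip: sum.swap[of "\<lambda>a b. ?C (g a) b"])
  also have "\<dots> = N * (N * ?P) + 2 * N * ?D - 2 * N * hook_poly I c g"
    by (simp add: H N_def algebra_simps)
  also have "?D = [:0, 1:] * pderiv ?P - N * ?P"
    using sum_cofactors_perm_char_poly[OF assms(1,3)] by (simp add: N_def)
  finally show ?thesis by (simp add: algebra_simps o_def)
qed

text \<open>The previous identity with x - 1 cancelled. The product rule yields a term 2 N x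
  \<Gamma>, which together with - 2 N \<Gamma> becomes 2 N (x - 1) \<Gamma>, so the right-hand side
  is divisible as well.\<close>

lemma sum_hook_poly_transpose:
  fixes g :: "'i \<Rightarrow> 'i"
  assumes "finite I" "c \<in> I" "g permutes I"
  defines "N \<equiv> of_nat (card I)"
  shows "(\<Sum>a\<in>I. \<Sum>b\<in>I. hook_poly I c (g \<circ> Transposition.transpose a b)) =
     2 * N * ([:0, 1:] * pderiv (hook_poly I c g)) - (N * N - 2 * N) * hook_poly I c g"
    (is "?L = ?R")
proof -
  have X: "[:0, 1:] = [:-1, 1:] + (1 :: real poly)" by (simp add: one_pCons)
  have "[:-1, 1:] * ?L = (\<Sum>a\<in>I. \<Sum>b\<in>I. perm_char_poly I (g \<circ> Transposition.transpose a b))"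
    unfolding sum_distrib_left using assms
    by (intro sum.cong refl perm_char_poly_eq_hook_poly[symmetric] permutes_compose permutes_swap_id)
  also have "\<dots> = 2 * N * ([:0, 1:] * pderiv ([:-1, 1:] * hook_poly I c g))
     - N * N * ([:-1, 1:] * hook_poly I c g) - 2 * N * hook_poly I c g"
    using sum_perm_char_poly_transpose[OF assms(1-3)] perm_char_poly_eq_hook_poly[OF assms(1-3)]
    by (simp add: N_def)
  also have "\<dots> = 2 * N * ([:0, 1:] * (hook_poly I c g + [:-1, 1:] * pderiv (hook_poly I c g)))
     - N * N * ([:-1, 1:] * hook_poly I c g) - 2 * N * hook_poly I c g"
    by (simp only: pderiv_mult) (simp add: pderiv_pCons)
  also have "\<dots> = [:-1, 1:] * ?R"
    unfolding X by (simp only: ring_distribs) (simp add: algebra_simps del: mult_pCons_left mult_pCons_right)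
  finally show ?thesis
    by (metis mult_cancel_left one_pCons pCons_eq_0_iff zero_neq_one)
qed

section \<open>The identity permutation and degree bounds\<close>

lemma perm_char_poly_id:
  assumes "finite I"
  shows "perm_char_poly I id = [:-1, 1:] ^ card I"
proof -
  have "perm_char_poly I id = (\<Prod>j\<in>I. char_cols id j j)"
    unfolding perm_char_poly_def
  proof (intro det_on_eq_prod_diag assms)
    fix p assume p: "p permutes I" "\<And>j. j \<in> I \<Longrightarrow> char_cols id j (p j) \<noteq> 0"
    have "p j = j" for j
      using p(2)[of j] permutes_not_in[OF p(1), of j]
      by (cases "j \<in> I") (auto simp: char_cols_def unit_col_def split: if_splits)
    then show "p = id" by auto
  qed
  then show ?thesis by (simp add: char_cols_def unit_col_def one_pCons)
qed

lemma hook_poly_id: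
  assumes "finite I" "a \<in> I"
  shows "hook_poly I a id = [:-1, 1:] ^ (card I - 1)"
proof -
  have "card I > 0" using assms by (auto simp: card_gt_0_iff)
  then have "card I = Suc (card I - 1)" by simp
  then have "[:-1, 1:] ^ card I = [:-1, 1:] * ([:-1, 1:] :: real poly) ^ (card I - 1)"
    by (metis power_Suc)
  then have "[:-1, 1:] * hook_poly I a id = [:-1, 1:] * [:-1, 1:] ^ (card I - 1)"
    using perm_char_poly_eq_hook_poly[OF assms permutes_id] perm_char_poly_id[OF assms(1)] by simp
  then show ?thesis by (simp only: mult_cancel_left) simp
qed

lemma degree_perm_char_poly_le:
  assumes "finite I"
  shows "degree (perm_char_poly I g) \<le> card I"
  unfolding perm_char_poly_def det_on_def
proof (intro degree_sum_le finite_permutations assms)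
  fix p
  have "degree (char_cols g j i) \<le> 1" for i j
    unfolding char_cols_def unit_col_def by (intro degree_diff_le) auto
  then have "(\<Sum>j\<in>I. degree (char_cols g j (p j))) \<le> of_nat (card I) * 1"
    by (rule sum_bounded_above)
  then have "degree (\<Prod>j\<in>I. char_cols g j (p j)) \<le> card I"
    using degree_prod_sum_le[OF assms, of "\<lambda>j. char_cols g j (p j)"] by (simp add: o_def)
  then show "degree (of_int (sign p) * (\<Prod>j\<in>I. char_cols g j (p j))) \<le> card I"
    by (simp add: of_int_poly order_trans[OF degree_smult_le])
qed

text \<open>Dividing by x - 1 costs one degree; hence for \<open>I = {1..n}\<close> the indices
  \<open>k < n\<close> cover all coefficients.\<close>

lemma degree_hook_poly_less:
  assumes "finite I" "a \<in> I" "g permutes I"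
  shows "degree (hook_poly I a g) < card I"
proof (cases "hook_poly I a g = 0")
  case True
  then show ?thesis using assms by (auto simp: card_gt_0_iff)
next
  case False
  then have "degree ([:-1, 1:] * hook_poly I a g) = Suc (degree (hook_poly I a g))"
    by (subst degree_mult_eq) auto
  then show ?thesis
    using degree_perm_char_poly_le[OF assms(1), of g] perm_char_poly_eq_hook_poly[OF assms] by simp
qed

section \<open>The value at 1 and the recognition of n-cycles\<close>

lemma permutes_orbit_returns:
  assumes "finite I" "g permutes I"
  obtains k where "(g ^^ k) ((g ^^ m) a) = a"
proof -
  have "permutation g" using assms by (auto simp: permutation_permutes)
  then obtain n where "g ^^ n = id" "n > m" by (rule permutation_is_nilpotent')
  moreover from this have "g ^^ n = (g ^^ (n - m)) \<circ> (g ^^ m)"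
    by (simp flip: funpow_add)
  ultimately have "(g ^^ (n - m)) ((g ^^ m) a) = a" by (metis comp_apply id_apply)
  then show ?thesis by (rule that)
qed

text \<open>At x = 1 the columns over a \<open>g\<close>-invariant set sum to zero. If the orbit of
  \<open>a\<close> covers \<open>I\<close>, the cofactors of column \<open>a\<close> all equal 1,
  and there are \<open>card I\<close> of them. Otherwise the complement of the orbit gives a
  dependence among columns other than \<open>a\<close>.\<close>

lemma poly_hook_poly_one:
  assumes "finite I" "a \<in> I" "g permutes I"
  shows "poly (hook_poly I a g) 1 =
    (if I \<subseteq> range (\<lambda>m. (g ^^ m) a) then of_nat (card I) else 0)"
proof -
  define N :: "'a \<Rightarrow> 'a \<Rightarrow> real" where "N = (\<lambda>j i. unit_col j i - unit_col (g j) i)"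
  have eval: "poly (hook_poly I a g) 1 = det_on I (N(a := \<lambda>_. 1))"
    unfolding hook_poly_def poly_det_on
    by (intro det_on_cong) (auto simp: N_def char_cols_def unit_col_def)
  have inj: "inj g" using assms(3) by (rule permutes_inj)
  have cols: "(\<Sum>j\<in>U. N j i) = 0" if "g ` U = U" for U i
  proof -
    have "(\<Sum>j\<in>U. unit_col (g j) i :: real) = (\<Sum>j\<in>g ` U. unit_col j i)"
      using inj by (subst sum.reindex) (auto simp: inj_on_def)
    then show ?thesis by (simp add: N_def sum_subtractf that)
  qed
  \<comment> \<open>The cofactors of column \<open>a\<close>; their sum over \<open>I\<close> is the
    value sought.\<close>
  define f where "f k = det_on I (N(a := unit_col k))" for k
  show ?thesis
  proof (cases "I \<subseteq> range (\<lambda>m. (g ^^ m) a)")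
    case True
    have "det_on I N = 0"
      using assms by (intro det_on_dependent_columns[of I I] cols) (auto simp: permutes_image)
    \<comment> \<open>In column \<open>a\<close>, \<open>N j\<close> repeats another column if
      \<open>j \<noteq> a\<close> and restores \<open>N\<close> if \<open>j = a\<close>. Either way
      the determinant is 0, so \<open>f\<close> is constant along the orbit.\<close>
    then have step: "f (g j) = f j" if "j \<in> I" for j
    proof -
      have "f j - f (g j) = det_on I (N(a := N j))"
        using assms by (simp add: f_def N_def det_on_upd_diff)
      also have "\<dots> = 0" using \<open>det_on I N = 0\<close> assms that by (simp add: det_on_upd_column)
      finally show ?thesis by simp
    qed
    have mem: "(g ^^ m) a \<in> I" for m
      using assms by (induction m) (auto simp: permutes_in_image)
    have "f ((g ^^ m) a) = f a" for m
      by (induction m) (auto simp: step mem)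
    then have const: "f j = f a" if "j \<in> I" for j using True that by auto
    have hits: "\<exists>k. (g ^^ k) j = a" if "j \<in> I" for j
    proof -
      from True that obtain m where "j = (g ^^ m) a" by auto
      then show ?thesis using permutes_orbit_returns[OF assms(1,3), of m a] by auto
    qed
    \<comment> \<open>A permutation \<open>p\<close> with nonzero product fixes \<open>a\<close> and
      sends any other \<open>j\<close> to \<open>j\<close> or \<open>g j\<close>. If it moved one
      point, injectivity would make it move the next point along the orbit, and finally
      \<open>a\<close>.\<close>
    have "f a = (\<Prod>j\<in>I. (N(a := unit_col a)) j j)"
      unfolding f_def
    proof (intro det_on_eq_prod_diag assms)
      fix p assume p: "p permutes I" "\<And>j. j \<in> I \<Longrightarrow> (N(a := unit_col a)) j (p j) \<noteq> 0"
      have pa: "p a = a" using p(2)[OF assms(2)] by (auto simp: unit_col_def split: if_splits)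
      have pj: "p j = j \<or> p j = g j" if "j \<in> I" "j \<noteq> a" for j
        using p(2)[OF that(1)] that(2) by (auto simp: N_def unit_col_def split: if_splits)
      have "p j = j" if "j \<in> I" for j
      proof (rule ccontr)
        assume j: "p j \<noteq> j"
        have "(g ^^ m) j \<in> I \<and> p ((g ^^ m) j) \<noteq> (g ^^ m) j" for m
        proof (induction m)
          case (Suc m)
          let ?k = "(g ^^ m) j"
          have "p ?k = g ?k" using Suc pj pa by metis
          then have "p (g ?k) \<noteq> g ?k"
            using Suc injD[OF permutes_inj[OF p(1)], of "g ?k" ?k] by auto
          then show ?case
            using Suc permutes_in_image[OF assms(3), of ?k] by simp
        qed (use j that in auto)
        then show False using hits[OF that] pa by metis
      qed
      then show "p = id" using p(1) by (auto simp: permutes_def fun_eq_iff)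
    qed
    also have "\<dots> = 1"
    proof (intro prod.neutral ballI)
      fix j assume "j \<in> I"
      have "g j \<noteq> j" if "j \<noteq> a"
      proof
        assume "g j = j"
        then have "(g ^^ k) j = j" for k by (induction k) auto
        then show False using hits[OF \<open>j \<in> I\<close>] that by auto
      qed
      then show "(N(a := unit_col a)) j j = 1" by (cases "j = a") (auto simp: N_def unit_col_def)
    qed
    finally have "f a = 1" .
    have "det_on I (N(a := \<lambda>_. 1)) = (\<Sum>k\<in>I. f k)"
      using assms by (simp add: det_on_upd_one f_def)
    also have "\<dots> = (\<Sum>k\<in>I. 1)" using const \<open>f a = 1\<close> by (intro sum.cong) (simp_all only:)
    finally show ?thesis using True eval by simp
  next
    case False
    define R where "R = range (\<lambda>m. (g ^^ m) a)"
    have "R \<subseteq> I"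
    proof -
      have "(g ^^ m) a \<in> I" for m using assms by (induction m) (auto simp: permutes_in_image)
      then show ?thesis by (auto simp: R_def)
    qed
    then have "finite R" using assms finite_subset by auto
    moreover have "g ` R \<subseteq> R"
    proof (unfold R_def image_image, intro image_subsetI)
      fix m show "g ((g ^^ m) a) \<in> range (\<lambda>m. (g ^^ m) a)"
        by (rule range_eqI[of _ _ "Suc m"]) simp
    qed
    ultimately have "g ` R = R"
      using inj_on_subset[OF inj] by (intro endo_inj_surj) auto
    then have U: "g ` (I - R) = I - R"
      by (simp add: image_set_diff[OF inj] permutes_image[OF assms(3)])
    \<comment> \<open>So the replaced column is not among those over \<open>I - R\<close>.\<close>
    have "a \<in> R" unfolding R_def by (rule range_eqI[of _ _ 0]) simp
    have "(\<Sum>j\<in>I - R. (N(a := \<lambda>_. 1)) j i) = 0" for i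
    proof -
      have "(\<Sum>j\<in>I - R. (N(a := \<lambda>_. 1)) j i) = (\<Sum>j\<in>I - R. N j i)"
        using \<open>a \<in> R\<close> by (intro sum.cong) auto
      then show ?thesis by (simp add: cols[OF U])
    qed
    moreover have "I - R \<noteq> {}" using False by (simp add: R_def)
    ultimately have "det_on I (N(a := \<lambda>_. 1)) = 0"
      by (intro det_on_dependent_columns[of I "I - R"] assms) auto
    then show ?thesis using False eval by simp
  qed
qed

text \<open>Powers of a cycle rotate its list, which takes 1 to every entry. Conversely,
  \<open>support g 1\<close> lists the orbit of 1, and the cycle on that list agrees with
  \<open>g\<close> on the orbit and fixes everything else, as \<open>g\<close> does.\<close>

lemma n_cycles_iff_transitive:
  assumes "g permutes {1..n}" "n \<ge> 1"
  shows "g \<in> n_cycles n \<longleftrightarrow> {1..n} \<subseteq> range (\<lambda>m. (g ^^ m) 1)"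
proof
  assume "g \<in> n_cycles n"
  then obtain cs where cs: "g = cycle_of_list cs" "distinct cs" "set cs = {1..n}"
    by (auto simp: n_cycles_def)
  have "1 \<in> set cs" using cs assms by auto
  then obtain i where i: "i < length cs" "cs ! i = 1" by (auto simp: in_set_conv_nth)
  show "{1..n} \<subseteq> range (\<lambda>m. (g ^^ m) 1)"
  proof
    fix j assume "j \<in> {1..n}"
    then obtain k where k: "k < length cs" "cs ! k = j" using cs by (metis in_set_conv_nth)
    \<comment> \<open>Rotating by \<open>?m\<close> brings entry \<open>k\<close> to position
      \<open>i\<close>; adding the length keeps the subtraction from truncating.\<close>
    let ?m = "k + length cs - i"
    have "(g ^^ ?m) 1 = map (g ^^ ?m) cs ! i" using i by simp
    also have "\<dots> = rotate ?m cs ! i" using cyclic_rotation[OF cs(2)] cs(1) by simp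
    also have "\<dots> = j" using i k by (simp add: nth_rotate)
    finally show "j \<in> range (\<lambda>m. (g ^^ m) 1)" by (metis rangeI)
  qed
next
  assume R: "{1..n} \<subseteq> range (\<lambda>m. (g ^^ m) 1)"
  have p: "permutation g" using assms by (auto simp: permutation_permutes)
  have "(g ^^ m) 1 \<in> {1..n}" for m
    using permutes_in_image[OF permutes_funpow[OF assms(1)], of m 1] assms(2) by simp
  then have "range (\<lambda>m. (g ^^ m) 1) = {1..n}"
    using R by (intro equalityI image_subsetI) simp_all
  then have set: "set (support g 1) = {1..n}"
    by (simp only: support_set[OF p])
  have "g = cycle_of_list (support g 1)"
  proof
    fix y show "g y = cycle_of_list (support g 1) y"
    proof (cases "y \<in> {1..n}")
      case True
      then have "y \<in> set (support g 1)" by (simp only: set)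
      then show ?thesis by (rule cycle_restrict[OF p])
    next
      case False
      then have "y \<notin> set (support g 1)" by (simp only: set not_False_eq_True)
      then show ?thesis
        using permutes_not_in[OF assms(1) False] by (metis id_outside_supp)
    qed
  qed
  then show "g \<in> n_cycles n"
    unfolding n_cycles_def mem_Collect_eq
    by (intro exI[of _ "support g 1"] conjI cycle_of_permutation[OF p] set)
qed

section \<open>Eigenfunctions of the transposition walk\<close>

lemma finite_verts: "finite (verts n)"
  by (simp add: sym_group_def finite_permutations)

lemma transpositions_eq_image:
  "transpositions n = (\<lambda>(a, b). Transposition.transpose a b) ` {(a, b). a \<in> {1..n} \<and> b \<in> {1..n} \<and> a < b}"
proof (intro equalityI subsetI)
  fix s assume "s \<in> transpositions n"
  then obtain a b where ab: "s = Transposition.transpose a b" "a \<in> {1..n}" "b \<in> {1..n}" "a \<noteq> b"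
    by (auto simp: transpositions_def)
  then show "s \<in> (\<lambda>(a, b). Transposition.transpose a b) ` {(a, b). a \<in> {1..n} \<and> b \<in> {1..n} \<and> a < b}"
    by (cases a b rule: linorder_cases)
      (auto intro: image_eqI[of _ _ "(a, b)"] image_eqI[of _ _ "(b, a)"] simp: transpose_commute)
qed (auto simp: transpositions_def)

lemma inj_on_transpose_less:
  fixes I :: "'a::linorder set"
  shows "inj_on (\<lambda>(a, b). Transposition.transpose a b) {(a, b). a \<in> I \<and> b \<in> I \<and> a < b}"
proof (rule inj_onI, clarify)
  fix a b c d :: 'a
  assume "Transposition.transpose a b = Transposition.transpose c d" and lt: "a < b" "c < d"
  then have "Transposition.transpose a b x = Transposition.transpose c d x" for x by simp
  from this[of a] this[of c] this[of b] lt show "a = c \<and> b = d"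
    by (auto simp: Transposition.transpose_def split: if_splits)
qed

text \<open>The square of pairs splits into the diagonal, which gives \<open>id\<close>, and two
  triangles, each running through every transposition exactly once.\<close>

lemma sum_transpose_pairs:
  fixes f :: "perm \<Rightarrow> 'a::comm_ring_1"
  shows "(\<Sum>a\<in>{1..n}. \<Sum>b\<in>{1..n}. f (Transposition.transpose a b)) =
    of_nat n * f id + 2 * (\<Sum>s\<in>transpositions n. f s)"
proof -
  let ?I = "{1..n}"
  let ?T = "{(a, b). a \<in> ?I \<and> b \<in> ?I \<and> a < b}"
  let ?F = "\<lambda>(a, b). f (Transposition.transpose a b)"
  have fin: "finite ?T" by (rule finite_subset[of _ "?I \<times> ?I"]) auto
  have S: "(\<Sum>s\<in>transpositions n. f s) = sum ?F ?T"
    unfolding transpositions_eq_image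
    by (subst sum.reindex[OF inj_on_transpose_less]) (simp add: case_prod_beta o_def)
  have S': "sum ?F (prod.swap ` ?T) = sum ?F ?T"
    by (subst sum.reindex) (auto simp: case_prod_beta o_def transpose_commute intro!: sum.cong)
  have D: "sum ?F ((\<lambda>a. (a, a)) ` ?I) = of_nat n * f id"
    by (subst sum.reindex) (auto simp: inj_on_def)
  have "?I \<times> ?I = (\<lambda>a. (a, a)) ` ?I \<union> (?T \<union> prod.swap ` ?T)"
    by (auto simp: image_iff)
  then have "sum ?F (?I \<times> ?I) = sum ?F ((\<lambda>a. (a, a)) ` ?I) + sum ?F (?T \<union> prod.swap ` ?T)"
    using fin by (simp only:) (rule sum.union_disjoint, auto)
  also have "sum ?F (?T \<union> prod.swap ` ?T) = sum ?F ?T + sum ?F (prod.swap ` ?T)"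
    using fin by (intro sum.union_disjoint) auto
  finally show ?thesis by (simp only: S S' D sum.cartesian_product mult_2)
qed

lemma card_transpositions: "2 * real (card (transpositions n)) = real n * (real n - 1)"
  using sum_transpose_pairs[of "\<lambda>_. 1 :: real" n] by (simp add: algebra_simps)

lemma finite_transpositions: "finite (transpositions n)"
proof -
  have "finite {(a, b). a \<in> {1..n} \<and> b \<in> {1..n} \<and> a < b}"
    by (rule finite_subset[of _ "{1..n} \<times> {1..n}"]) auto
  then show ?thesis unfolding transpositions_eq_image by (rule finite_imageI)
qed

lemma transpositions_subset_verts: "transpositions n \<subseteq> verts n"
  by (auto simp: transpositions_def sym_group_carrier permutes_swap_id)

text \<open>The operator x d/dx multiplies the coefficient of x^k by k. Removing the diagonal pairs
  moves one n \<Gamma> across, and n^2 - 2n + n is twice the number of transpositions.\<close>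

lemma coeff_hook_poly_eigen:
  assumes "n \<ge> 1" "g \<in> verts n"
  shows "(\<Sum>s\<in>transpositions n. coeff (hook_poly {1..n} 1 (g \<circ> s)) k) =
    (real n * real k - real (card (transpositions n))) * coeff (hook_poly {1..n} 1 g) k"
proof -
  let ?h = "hook_poly {1..n} 1"
  have X: "coeff ([:0, 1:] * pderiv p) k = real k * coeff p k" for p :: "real poly"
    by (cases k) (simp_all add: coeff_pderiv)
  have N: "coeff (of_nat m * p) k = real m * coeff p k" for m and p :: "real poly"
    by (simp add: of_nat_poly)
  have "of_nat n * ?h g + 2 * (\<Sum>s\<in>transpositions n. ?h (g \<circ> s)) =
     2 * of_nat n * ([:0, 1:] * pderiv (?h g)) - (of_nat n * of_nat n - 2 * of_nat n) * ?h g"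
    using sum_hook_poly_transpose[of "{1..n}" 1 g] sum_transpose_pairs[of "\<lambda>s. ?h (g \<circ> s)" n] assms
    by (simp add: sym_group_carrier)
  \<comment> \<open>All scalars take the form \<open>of_nat\<close>, so that \<open>N\<close>
    extracts each coefficient.\<close>
  then have "of_nat n * ?h g + of_nat 2 * (\<Sum>s\<in>transpositions n. ?h (g \<circ> s)) =
     of_nat (2 * n) * ([:0, 1:] * pderiv (?h g)) - of_nat (n * n) * ?h g + of_nat (2 * n) * ?h g"
    by (simp only: of_nat_mult of_nat_numeral) (simp only: algebra_simps)
  then have "coeff (of_nat n * ?h g + of_nat 2 * (\<Sum>s\<in>transpositions n. ?h (g \<circ> s))) k =
     coeff (of_nat (2 * n) * ([:0, 1:] * pderiv (?h g)) - of_nat (n * n) * ?h g + of_nat (2 * n) * ?h g) k"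
    by (rule arg_cong)
  then have "real n * coeff (?h g) k + 2 * (\<Sum>s\<in>transpositions n. coeff (?h (g \<circ> s)) k) =
     2 * real n * (real k * coeff (?h g) k) - real n * real n * coeff (?h g) k + 2 * real n * coeff (?h g) k"
    by (simp only: coeff_add coeff_diff N X coeff_sum) simp
  then have "2 * (\<Sum>s\<in>transpositions n. coeff (?h (g \<circ> s)) k) =
     (2 * (real n * real k) - real n * (real n - 1)) * coeff (?h g) k"
    by (simp add: algebra_simps)
  then show ?thesis unfolding card_transpositions[symmetric] by (simp add: algebra_simps)
qed

lemma n_cycles_subset_verts: "n_cycles n \<subseteq> verts n"
proof
  fix g assume "g \<in> n_cycles n"
  then obtain cs where "g = cycle_of_list cs" "set cs = {1..n}" by (auto simp: n_cycles_def)
  then show "g \<in> verts n" using cycle_permutes[of cs] by (simp add: sym_group_carrier)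
qed

lemma sum_coeff_hook_poly:
  assumes "n \<ge> 1" "g \<in> verts n"
  shows "(\<Sum>k<n. coeff (hook_poly {1..n} 1 g) k) = (if g \<in> n_cycles n then real n else 0)"
proof -
  let ?h = "hook_poly {1..n} 1 g"
  have g: "g permutes {1..n}" using assms by (simp add: sym_group_carrier)
  have "degree ?h < n" using degree_hook_poly_less[of "{1..n}" 1 g] g assms by simp
  then have "(\<Sum>k<n. coeff ?h k) = (\<Sum>k\<le>degree ?h. coeff ?h k)"
    by (intro sum.mono_neutral_right) (auto simp: coeff_eq_0)
  also have "\<dots> = poly ?h 1" by (simp add: poly_altdef)
  also have "\<dots> = (if g \<in> n_cycles n then real n else 0)"
    using poly_hook_poly_one[of "{1..n}" 1 g] n_cycles_iff_transitive[OF g assms(1)] g assms by simp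
  finally show ?thesis .
qed

lemma sum_abs_coeff_hook_poly_id:
  assumes "n \<ge> 1"
  shows "(\<Sum>k<n. \<bar>coeff (hook_poly {1..n} 1 id) k\<bar>) = 2 ^ (n - 1)"
proof -
  have "(\<Sum>k<n. \<bar>coeff (hook_poly {1..n} 1 id) k\<bar>) = (\<Sum>k\<le>n - 1. real ((n - 1) choose k))"
    using assms hook_poly_id[of "{1..n}" 1]
    by (intro sum.cong) (auto simp: coeff_linear_poly_power abs_mult power_abs)
  also have "\<dots> = real (\<Sum>k\<le>n - 1. (n - 1) choose k)" by simp
  also have "\<dots> = 2 ^ (n - 1)" by (simp only: choose_row_sum) simp
  finally show ?thesis .
qed

section \<open>The Szegedy walk\<close>

text \<open>The amplitude of the arc \<open>(g, h)\<close> both in \<open>phi n g\<close> and in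
  \<open>phi' n h\<close>. It is symmetric because transpositions are involutions.\<close>

definition arc_amp :: "nat \<Rightarrow> perm \<Rightarrow> perm \<Rightarrow> real" where
  "arc_amp n g h = (if \<exists>s\<in>transpositions n. h = g \<circ> s then 1 / sqrt (real (card (transpositions n))) else 0)"

lemma transposition_involution:
  assumes "s \<in> transpositions n"
  shows "s \<circ> s = id"
  using assms by (auto simp: transpositions_def)

lemma comp_transposition_eq_iff:
  assumes "s \<in> transpositions n"
  shows "g \<circ> s = h \<longleftrightarrow> g = h \<circ> s"
  using transposition_involution[OF assms] by (metis comp_assoc comp_id)

lemma arc_amp_commute: "arc_amp n g h = arc_amp n h g"
  by (auto simp: arc_amp_def) (metis comp_transposition_eq_iff)+

lemma comp_left_cancel_verts:
  fixes g s s' :: perm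
  assumes "g \<in> verts n"
  shows "g \<circ> s = g \<circ> s' \<longleftrightarrow> s = s'"
  using permutes_inj[OF assms[unfolded sym_group_carrier]] by (auto simp: fun_eq_iff inj_def)

text \<open>By left cancellation at most one transposition satisfies \<open>h = g \<circ> s\<close>,
  so the sum is an indicator.\<close>

lemma sum_ket_eq_arc_amp:
  assumes "g \<in> verts n"
  shows "complex_of_real (1 / sqrt (real (card (transpositions n)))) *
     (\<Sum>s\<in>transpositions n. if h = g \<circ> s then 1 else 0) = complex_of_real (arc_amp n g h)"
proof (cases "\<exists>s\<in>transpositions n. h = g \<circ> s")
  case True
  then obtain s where s: "s \<in> transpositions n" "h = g \<circ> s" by blast
  have "(\<Sum>s\<in>transpositions n. if h = g \<circ> s then 1 else 0 :: complex) =
      (\<Sum>s'\<in>transpositions n. if s = s' then 1 else 0)"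
    using s comp_left_cancel_verts[OF assms] by (intro sum.cong) simp_all
  then show ?thesis using s True finite_transpositions by (simp add: arc_amp_def)
qed (auto simp: arc_amp_def intro!: sum.neutral)

lemma inv_transposition:
  assumes "s \<in> transpositions n"
  shows "inv\<^bsub>sym_group n\<^esub> s = s"
proof (rule group.inv_equality[OF sym_group_is_group])
  show "s \<otimes>\<^bsub>sym_group n\<^esub> s = \<one>\<^bsub>sym_group n\<^esub>"
    using transposition_involution[OF assms] by (simp add: sym_group_mult sym_group_one)
qed (use assms transpositions_subset_verts in blast)+

lemma phi_eq:
  assumes "g \<in> verts n"
  shows "phi n g (g', h') = (if g' = g then complex_of_real (arc_amp n g' h') else 0)"
  by (cases "g' = g") (use sum_ket_eq_arc_amp[OF assms] in \<open>simp_all add: phi_def ket_def sym_group_mult\<close>)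

lemma phi'_eq:
  assumes "g \<in> verts n"
  shows "phi' n g (g', h') = (if h' = g then complex_of_real (arc_amp n g' h') else 0)"
proof (cases "h' = g")
  case True
  then show ?thesis using sum_ket_eq_arc_amp[OF assms, of g'] arc_amp_commute[of n g' g]
    by (simp add: phi'_def ket_def sym_group_mult inv_transposition cong: sum.cong)
qed (simp add: phi'_def ket_def)

lemma op_A_eq:
  assumes "y \<in> verts n"
  shows "op_A n (g, h) y = (if g = y then complex_of_real (arc_amp n g h) else 0)"
proof -
  have "op_A n (g, h) y = (\<Sum>x\<in>verts n. if y = x then phi n y (g, h) else 0)"
    unfolding op_A_def ketbra_def ket_def by (intro sum.cong) auto
  then show ?thesis using assms by (simp add: finite_verts phi_eq)
qed

lemma op_B_eq:
  assumes "y \<in> verts n"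
  shows "op_B n (g, h) y = (if h = y then complex_of_real (arc_amp n g h) else 0)"
proof -
  have "op_B n (g, h) y = (\<Sum>x\<in>verts n. if y = x then phi' n y (g, h) else 0)"
    unfolding op_B_def ketbra_def ket_def by (intro sum.cong) auto
  then show ?thesis using assms by (simp add: finite_verts phi'_eq)
qed

lemma psi_id_eq: "psi_id n (g, h) = (if g = id then complex_of_real (arc_amp n g h) else 0)"
proof -
  have "id \<in> verts n" by (simp add: sym_group_carrier permutes_id)
  from sum_ket_eq_arc_amp[OF this, of h] show ?thesis
    by (simp add: psi_id_def ket_def sym_group_one)
qed

lemma finite_n_cycles: "finite (n_cycles n)"
  using n_cycles_subset_verts finite_verts by (rule finite_subset)

text \<open>This exhibits the target state as A applied to the normalized indicator function of the
  n-cycles.\<close>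

lemma psi_cycles_eq:
  "psi_cycles n (g, h) = (if g \<in> n_cycles n then complex_of_real (arc_amp n g h / sqrt (fact (n - 1))) else 0)"
proof -
  let ?d = "real (card (transpositions n))"
  have "psi_cycles n (g, h) = complex_of_real (1 / sqrt (fact (n - 1))) *
     (\<Sum>c\<in>n_cycles n. complex_of_real (1 / sqrt ?d) *
        (\<Sum>s\<in>transpositions n. ket (c, c \<circ> s) (g, h)))"
    by (simp add: psi_cycles_def sym_group_mult real_sqrt_mult sum_divide_distrib mult.commute)
  also have "\<dots> = complex_of_real (1 / sqrt (fact (n - 1))) *
     (\<Sum>c\<in>n_cycles n. if g = c then complex_of_real (arc_amp n g h) else 0)"
    using sum_ket_eq_arc_amp[of g n h] n_cycles_subset_verts[of n]
    by (intro arg_cong2[where f = "(*)"] sum.cong refl) (auto simp: ket_def)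
  finally show ?thesis by (simp add: finite_n_cycles)
qed

text \<open>The squared amplitudes are the transition probabilities of the random walk.\<close>

lemma sum_arc_amp_sq:
  fixes v :: "perm \<Rightarrow> real"
  assumes "g \<in> verts n"
  shows "(\<Sum>h\<in>verts n. v h * (arc_amp n g h)\<^sup>2) =
    (\<Sum>s\<in>transpositions n. v (g \<circ> s)) / real (card (transpositions n))"
proof -
  have sub: "(\<circ>) g ` transpositions n \<subseteq> verts n"
    using assms transpositions_subset_verts[of n]
    by (intro image_subsetI) (auto simp: sym_group_carrier subset_iff intro!: permutes_compose)
  have inj: "inj_on ((\<circ>) g) (transpositions n)"
    using comp_left_cancel_verts[OF assms] by (auto intro: inj_onI)
  have "(\<Sum>h\<in>verts n. v h * (arc_amp n g h)\<^sup>2) =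
      (\<Sum>h\<in>(\<circ>) g ` transpositions n. v h * (arc_amp n g h)\<^sup>2)"
    using sub finite_verts by (intro sum.mono_neutral_right) (auto simp: arc_amp_def)
  also have "\<dots> = (\<Sum>s\<in>transpositions n. v (g \<circ> s) * (arc_amp n g (g \<circ> s))\<^sup>2)"
    by (simp add: sum.reindex[OF inj])
  also have "\<dots> = (\<Sum>s\<in>transpositions n. v (g \<circ> s) / real (card (transpositions n)))"
    by (intro sum.cong) (auto simp: arc_amp_def power_divide)
  finally show ?thesis by (simp add: sum_divide_distrib)
qed

section \<open>Evolution of row vectors under the walk\<close>

text \<open>The bra is evolved instead of the ket: the target state is the one that splits into
  eigenfunctions, and \<open>op_pow\<close> exposes its leftmost factor.\<close>

definition row_mult :: "'a set \<Rightarrow> 'a vect \<Rightarrow> ('a, 'b) op \<Rightarrow> 'b vect" where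
  "row_mult X u M = (\<lambda>y. \<Sum>x\<in>X. u x * M x y)"

lemma row_mult_op_mult:
  "row_mult X u (op_mult Y M N) = row_mult Y (row_mult X u M) N"
  unfolding row_mult_def op_mult_def
  by (simp add: sum_distrib_left sum_distrib_right mult.assoc fun_eq_iff) (auto intro: sum.swap)

lemma row_mult_cong:
  "(\<And>x. x \<in> X \<Longrightarrow> u x = u' x) \<Longrightarrow> row_mult X u M = row_mult X u' M"
  by (simp add: row_mult_def)

lemma row_mult_one: "finite X \<Longrightarrow> x \<in> X \<Longrightarrow> row_mult X u op_one x = u x"
  by (simp add: row_mult_def op_one_def if_distrib cong: if_cong)

lemma row_mult_reflection:
  assumes "finite X" "x \<in> X"
  shows "row_mult X u (reflection Y M) x =
    2 * (\<Sum>y\<in>Y. (\<Sum>x'\<in>X. u x' * M x' y) * cnj (M x y)) - u x"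
proof -
  have "row_mult X u (reflection Y M) x =
     2 * row_mult Y (row_mult X u M) (op_adj M) x - row_mult X u op_one x"
    unfolding row_mult_op_mult[symmetric]
    by (simp add: row_mult_def reflection_def right_diff_distrib sum_subtractf sum_distrib_left mult_ac)
  then show ?thesis using assms by (simp add: row_mult_one) (simp add: row_mult_def op_adj_def)
qed

text \<open>In operator notation this is \<open>a A v + b B v\<close>.\<close>

definition walk_vec :: "nat \<Rightarrow> (perm \<Rightarrow> real) \<Rightarrow> real \<Rightarrow> real \<Rightarrow> (perm \<times> perm) vect" where
  "walk_vec n v a b = (\<lambda>(g, h). complex_of_real ((a * v g + b * v h) * arc_amp n g h))"

text \<open>The sums are A\<dagger> and B\<dagger> applied to a A v + b B v. Here A\<dagger>A =
  B\<dagger>B = I, while A\<dagger>B and B\<dagger>A are the transition operator of the random walk,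
  which acts on v as r.\<close>

lemma sum_walk_vec:
  fixes v :: "perm \<Rightarrow> real"
  assumes "card (transpositions n) > 0" "g \<in> verts n"
    and "(\<Sum>s\<in>transpositions n. v (g \<circ> s)) = real (card (transpositions n)) * r * v g"
  shows "(\<Sum>h\<in>verts n. walk_vec n v a b (g, h) * complex_of_real (arc_amp n g h)) =
      complex_of_real ((a + b * r) * v g)"
    and "(\<Sum>h\<in>verts n. walk_vec n v a b (h, g) * complex_of_real (arc_amp n h g)) =
      complex_of_real ((b + a * r) * v g)"
proof -
  have const: "(\<Sum>h\<in>verts n. (arc_amp n g h)\<^sup>2) = 1"
    using sum_arc_amp_sq[OF assms(2), of "\<lambda>_. 1"] assms(1) by simp
  have eig: "(\<Sum>h\<in>verts n. v h * (arc_amp n g h)\<^sup>2) = r * v g"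
    using sum_arc_amp_sq[OF assms(2), of v] assms(1,3) by simp
  have lin: "(\<Sum>h\<in>verts n. (p * v g + q * v h) * (arc_amp n g h)\<^sup>2) = (p + q * r) * v g" for p q
  proof -
    have "(\<Sum>h\<in>verts n. (p * v g + q * v h) * (arc_amp n g h)\<^sup>2) =
       p * v g * (\<Sum>h\<in>verts n. (arc_amp n g h)\<^sup>2) + q * (\<Sum>h\<in>verts n. v h * (arc_amp n g h)\<^sup>2)"
      by (simp add: sum_distrib_left sum.distrib algebra_simps)
    then show ?thesis by (simp add: const eig algebra_simps)
  qed
  have "(\<Sum>h\<in>verts n. walk_vec n v a b (g, h) * complex_of_real (arc_amp n g h)) =
      complex_of_real (\<Sum>h\<in>verts n. (a * v g + b * v h) * (arc_amp n g h)\<^sup>2)"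
    by (simp add: walk_vec_def power2_eq_square mult.assoc)
  then show "(\<Sum>h\<in>verts n. walk_vec n v a b (g, h) * complex_of_real (arc_amp n g h)) =
      complex_of_real ((a + b * r) * v g)" by (simp only: lin)
  have "(\<Sum>h\<in>verts n. walk_vec n v a b (h, g) * complex_of_real (arc_amp n h g)) =
      complex_of_real (\<Sum>h\<in>verts n. (b * v g + a * v h) * (arc_amp n g h)\<^sup>2)"
    by (simp add: walk_vec_def power2_eq_square mult.assoc arc_amp_commute[of n _ g] add.commute)
  then show "(\<Sum>h\<in>verts n. walk_vec n v a b (h, g) * complex_of_real (arc_amp n h g)) =
      complex_of_real ((b + a * r) * v g)" by (simp only: lin)
qed

text \<open>Projecting by AA\<dagger> gives (a + b r) A v; doubling and subtracting the vector turns
  (a, b) into (a + 2 r b, - b). The same holds for B with the roles exchanged. All entries are real,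
  so rows and columns transform alike.\<close>

lemma walk_vec_reflections:
  fixes v :: "perm \<Rightarrow> real"
  assumes "card (transpositions n) > 0" "x \<in> arcs n"
    and eig: "\<And>g. g \<in> verts n \<Longrightarrow>
      (\<Sum>s\<in>transpositions n. v (g \<circ> s)) = real (card (transpositions n)) * r * v g"
  shows "row_mult (arcs n) (walk_vec n v a b) (reflection (verts n) (op_A n)) x =
      walk_vec n v (a + 2 * r * b) (- b) x"
    and "row_mult (arcs n) (walk_vec n v a b) (reflection (verts n) (op_B n)) x =
      walk_vec n v (- a) (b + 2 * r * a) x"
proof -
  obtain g h where x: "x = (g, h)" "g \<in> verts n" "h \<in> verts n" using assms(2) by auto
  have fin: "finite (arcs n)" by (simp add: finite_verts)
  have A: "(\<Sum>x'\<in>arcs n. walk_vec n v a b x' * op_A n x' y) = complex_of_real ((a + b * r) * v y)"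
    if "y \<in> verts n" for y
  proof -
    have "(\<Sum>x'\<in>arcs n. walk_vec n v a b x' * op_A n x' y) = 
      (\<Sum>g\<in>verts n. if y = g then \<Sum>h\<in>verts n. walk_vec n v a b (g, h) * complex_of_real (arc_amp n g h) else 0)"
      using that by (subst sum.cartesian_product') (auto simp: op_A_eq intro!: sum.cong)
    then show ?thesis using that sum_walk_vec(1)[OF assms(1) that eig[OF that], of a b] finite_verts by simp
  qed
  have B: "(\<Sum>x'\<in>arcs n. walk_vec n v a b x' * op_B n x' y) = complex_of_real ((b + a * r) * v y)"
    if "y \<in> verts n" for y
  proof -
    have "(\<Sum>x'\<in>arcs n. walk_vec n v a b x' * op_B n x' y) = 
      (\<Sum>g\<in>verts n. \<Sum>h\<in>verts n. if y = h then walk_vec n v a b (g, y) * complex_of_real (arc_amp n g y) else 0)"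
      using that by (subst sum.cartesian_product') (auto simp: op_B_eq intro!: sum.cong)
    then show ?thesis using that sum_walk_vec(2)[OF assms(1) that eig[OF that], of a b] finite_verts by simp
  qed
  have "(\<Sum>y\<in>verts n. (\<Sum>x'\<in>arcs n. walk_vec n v a b x' * op_A n x' y) * cnj (op_A n x y)) =
     (\<Sum>y\<in>verts n. if g = y then complex_of_real ((a + b * r) * v g * arc_amp n g h) else 0)"
    by (intro sum.cong refl) (auto simp: A op_A_eq x)
  then show "row_mult (arcs n) (walk_vec n v a b) (reflection (verts n) (op_A n)) x =
      walk_vec n v (a + 2 * r * b) (- b) x"
    using x by (subst row_mult_reflection[OF fin assms(2)])
      (simp add: finite_verts walk_vec_def algebra_simps)
  have "(\<Sum>y\<in>verts n. (\<Sum>x'\<in>arcs n. walk_vec n v a b x' * op_B n x' y) * cnj (op_B n x y)) =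
     (\<Sum>y\<in>verts n. if h = y then complex_of_real ((b + a * r) * v h * arc_amp n g h) else 0)"
    by (intro sum.cong refl) (auto simp: B op_B_eq x)
  then show "row_mult (arcs n) (walk_vec n v a b) (reflection (verts n) (op_B n)) x =
      walk_vec n v (- a) (b + 2 * r * a) x"
    using x by (subst row_mult_reflection[OF fin assms(2)])
      (simp add: finite_verts walk_vec_def algebra_simps)
qed

text \<open>A row vector meets the left factor of the walk first, so the B-reflection acts before
  the A-reflection.\<close>

lemma row_mult_szegedy_walk:
  fixes v :: "perm \<Rightarrow> real"
  assumes "card (transpositions n) > 0" "x \<in> arcs n"
    and eig: "\<And>g. g \<in> verts n \<Longrightarrow>
      (\<Sum>s\<in>transpositions n. v (g \<circ> s)) = real (card (transpositions n)) * r * v g"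
  shows "row_mult (arcs n) (walk_vec n v a b) (szegedy_walk n) x =
    walk_vec n v (- a + 2 * r * (b + 2 * r * a)) (- (b + 2 * r * a)) x"
proof -
  have "row_mult (arcs n) (walk_vec n v a b) (szegedy_walk n) x =
     row_mult (arcs n) (walk_vec n v (- a) (b + 2 * r * a)) (reflection (verts n) (op_A n)) x"
    unfolding szegedy_walk_def row_mult_op_mult
    by (subst row_mult_cong[OF walk_vec_reflections(2)[OF assms(1) _ eig]]) auto
  then show ?thesis by (simp only: walk_vec_reflections(1)[OF assms])
qed

text \<open>
  Here \<open>a\<^sup>2 + b\<^sup>2 + 2 r a b\<close> is the squared norm of \<open>a A v + b B v\<close> divided by that of \<open>v\<close>,
  an invariant of the unitary walk.
\<close>

lemma norm_sum_walk_vec_pow_le: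
  fixes v :: "perm \<Rightarrow> real"
  assumes "card (transpositions n) > 0" "\<bar>r\<bar> \<le> 1" "a\<^sup>2 + b\<^sup>2 + 2 * r * a * b = 1"
    and eig: "\<And>g. g \<in> verts n \<Longrightarrow>
      (\<Sum>s\<in>transpositions n. v (g \<circ> s)) = real (card (transpositions n)) * r * v g"
  shows "cmod (\<Sum>y\<in>arcs n. row_mult (arcs n) (walk_vec n v a b) (op_pow (arcs n) (szegedy_walk n) t) y
    * psi_id n y) \<le> \<bar>v id\<bar>"
  using assms(3)
\<comment> \<open>Each step of the walk changes the coefficients, so only the value 1 of the
  quadratic form is carried along.\<close>
proof (induction t arbitrary: a b)
  case 0
  have id: "id \<in> verts n" by (simp add: sym_group_carrier permutes_id)
  have "(\<Sum>y\<in>arcs n. row_mult (arcs n) (walk_vec n v a b) op_one y * psi_id n y) =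
      (\<Sum>y\<in>arcs n. walk_vec n v a b y * psi_id n y)"
    by (intro sum.cong refl) (simp add: row_mult_one finite_verts)
  \<comment> \<open>The initial state is A applied to the identity, so the overlap is A\<dagger>(a A
    v + b B v) evaluated there.\<close>
  also have "\<dots> = (\<Sum>g\<in>verts n. if g = id then
      \<Sum>h\<in>verts n. walk_vec n v a b (g, h) * complex_of_real (arc_amp n g h) else 0)"
    by (subst sum.cartesian_product') (auto simp: psi_id_eq intro!: sum.cong)
  also have "\<dots> = (\<Sum>h\<in>verts n. walk_vec n v a b (id, h) * complex_of_real (arc_amp n id h))"
    using id by (simp add: finite_verts)
  also have "\<dots> = complex_of_real ((a + b * r) * v id)"
    by (rule sum_walk_vec(1)[OF assms(1) id eig[OF id]])
  finally have "cmod (\<Sum>y\<in>arcs n. row_mult (arcs n) (walk_vec n v a b) op_one y * psi_id n y) =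
      \<bar>a + b * r\<bar> * \<bar>v id\<bar>"
    by (simp only: norm_of_real abs_mult)
  moreover have "\<bar>a + b * r\<bar> \<le> 1"
  proof -
    have "r\<^sup>2 \<le> 1" using assms(2) by (simp add: abs_square_le_1)
    \<comment> \<open>Completing the square writes the quadratic form as (a + b r)^2 + (1 - r^2)
      b^2.\<close>
    then have "(a + b * r)\<^sup>2 \<le> (a + b * r)\<^sup>2 + (1 - r\<^sup>2) * b\<^sup>2" by simp
    also have "\<dots> = 1" using 0 by (simp add: power2_eq_square algebra_simps)
    finally show ?thesis by (simp add: abs_square_le_1)
  qed
  ultimately show ?case using mult_right_mono[of "\<bar>a + b * r\<bar>" 1 "\<bar>v id\<bar>"] by (simp add: id_def)
next
  case (Suc t)
  have "row_mult (arcs n) (walk_vec n v a b) (op_pow (arcs n) (szegedy_walk n) (Suc t)) =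
     row_mult (arcs n) (walk_vec n v (- a + 2 * r * (b + 2 * r * a)) (- (b + 2 * r * a)))
       (op_pow (arcs n) (szegedy_walk n) t)"
    unfolding op_pow.simps row_mult_op_mult
    by (intro row_mult_cong row_mult_szegedy_walk assms(1) eig)
  moreover have "(- a + 2 * r * (b + 2 * r * a))\<^sup>2 + (- (b + 2 * r * a))\<^sup>2 +
     2 * r * (- a + 2 * r * (b + 2 * r * a)) * (- (b + 2 * r * a)) = 1"
    using Suc.prems by (simp add: power2_eq_square algebra_simps)
  ultimately show ?case using Suc.IH by simp
qed

text \<open>The target bra is \<open>?c\<close> times the sum of the
  \<open>walk_vec n (v k) 1 0\<close>; coefficients (1, 0) give the quadratic form the value 1, so
  each summand contributes at most \<open>\<bar>v k id\<bar>\<close>.\<close>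

lemma norm_sandwich_le:
  assumes "n \<ge> 2"
  shows "cmod (sandwich (arcs n) (psi_cycles n) (op_pow (arcs n) (szegedy_walk n) t) (psi_id n))
    \<le> 2 ^ (n - 1) / (real n * sqrt (fact (n - 1)))"
proof -
  let ?W = "op_pow (arcs n) (szegedy_walk n) t"
  let ?c = "1 / (real n * sqrt (fact (n - 1)))"
  let ?d = "real (card (transpositions n))"
  define v where "v k g = coeff (hook_poly {1..n} 1 g) k" for k and g :: perm
  have d: "2 * ?d = real n * (real n - 1)" by (rule card_transpositions)
  have "0 < real n * (real n - 1)" using assms by (intro mult_pos_pos) auto
  then have pos: "?d > 0" using d by linarith
  \<comment> \<open>The factor 1/n in \<open>?c\<close> compensates for the eigenfunctions adding up
    to n, not 1, on the n-cycles.\<close>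
  have psi: "cnj (psi_cycles n x) = complex_of_real ?c * (\<Sum>k<n. walk_vec n (v k) 1 0 x)"
    if x_in: "x \<in> arcs n" for x
  proof -
    obtain g h where x: "x = (g, h)" "g \<in> verts n" using x_in by auto
    have "(\<Sum>k<n. walk_vec n (v k) 1 0 x) = complex_of_real ((\<Sum>k<n. v k g) * arc_amp n g h)"
      by (simp add: walk_vec_def x sum_distrib_right)
    also have "(\<Sum>k<n. v k g) = (if g \<in> n_cycles n then real n else 0)"
      using sum_coeff_hook_poly[of n g] x assms by (simp add: v_def)
    finally show ?thesis using assms by (simp add: x psi_cycles_eq)
  qed
  have "sandwich (arcs n) (psi_cycles n) ?W (psi_id n) =
      (\<Sum>y\<in>arcs n. row_mult (arcs n) (\<lambda>x. cnj (psi_cycles n x)) ?W y * psi_id n y)"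
    unfolding sandwich_def row_mult_def by (subst sum.swap) (simp add: sum_distrib_right)
  also have "row_mult (arcs n) (\<lambda>x. cnj (psi_cycles n x)) ?W =
      row_mult (arcs n) (\<lambda>x. complex_of_real ?c * (\<Sum>k<n. walk_vec n (v k) 1 0 x)) ?W"
    by (intro row_mult_cong psi)
  also have "\<dots> = (\<lambda>y. complex_of_real ?c * (\<Sum>k<n. row_mult (arcs n) (walk_vec n (v k) 1 0) ?W y))"
    unfolding row_mult_def
    by (subst sum.swap) (simp only: sum_distrib_left sum_distrib_right mult.assoc)
  also have "(\<Sum>y\<in>arcs n. complex_of_real ?c * (\<Sum>k<n. row_mult (arcs n) (walk_vec n (v k) 1 0) ?W y) * psi_id n y)
    = complex_of_real ?c * (\<Sum>k<n. \<Sum>y\<in>arcs n. row_mult (arcs n) (walk_vec n (v k) 1 0) ?W y * psi_id n y)"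
    by (subst sum.swap) (simp only: sum_distrib_left sum_distrib_right mult.assoc)
  finally have "cmod (sandwich (arcs n) (psi_cycles n) ?W (psi_id n)) =
      ?c * cmod (\<Sum>k<n. \<Sum>y\<in>arcs n. row_mult (arcs n) (walk_vec n (v k) 1 0) ?W y * psi_id n y)"
    by (simp only: norm_mult norm_of_real) simp
  also have "\<dots> \<le> ?c * (\<Sum>k<n. \<bar>v k id\<bar>)"
  proof (rule mult_left_mono, rule order_trans[OF norm_sum], rule sum_mono)
    fix k assume k: "k \<in> {..<n}"
    let ?r = "(real n * real k - ?d) / ?d"
    have "0 \<le> real n * real k" by simp
    \<comment> \<open>From k \<le> n - 1; so the eigenvalue \<open>?r\<close> lies between -1 and
      1.\<close>
    moreover have "real n * real k \<le> 2 * ?d" unfolding d using k by (intro mult_left_mono) auto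
    ultimately have "\<bar>?r\<bar> \<le> 1" using pos by (simp add: abs_le_iff divide_le_eq le_divide_eq)
    moreover have "(\<Sum>s\<in>transpositions n. v k (g \<circ> s)) = ?d * ?r * v k g" if "g \<in> verts n" for g
      using coeff_hook_poly_eigen[of n g k] that pos assms by (simp add: v_def)
    ultimately show "cmod (\<Sum>y\<in>arcs n. row_mult (arcs n) (walk_vec n (v k) 1 0) ?W y * psi_id n y) \<le> \<bar>v k id\<bar>"
      using pos by (intro norm_sum_walk_vec_pow_le[of n ?r]) auto
  qed simp
  also have "(\<Sum>k<n. \<bar>v k id\<bar>) = 2 ^ (n - 1)"
    using sum_abs_coeff_hook_poly_id[of n] assms by (simp add: v_def)
  finally show ?thesis by simp
qed

theorem theorem1:
  fixes \<beta> :: real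
  assumes "\<beta> > 81 / 16"
  shows "\<exists>C::real. \<forall>n::nat. \<forall>t::nat. n \<ge> 2 \<longrightarrow>
    (cmod (sandwich (arcs n) (psi_cycles n) (op_pow (arcs n) (szegedy_walk n) t) (psi_id n)))\<^sup>2
      \<le> C * (real n ^ 20 * \<beta> ^ (2 * n) / fact n)"
proof (intro exI[of _ 1] allI impI)
  fix n t :: nat
  assume n: "n \<ge> 2"
  have "(cmod (sandwich (arcs n) (psi_cycles n) (op_pow (arcs n) (szegedy_walk n) t) (psi_id n)))\<^sup>2
      \<le> (2 ^ (n - 1) / (real n * sqrt (fact (n - 1))))\<^sup>2"
    by (intro power_mono norm_sandwich_le n norm_ge_zero)
  also have "\<dots> = (2 ^ (n - 1))\<^sup>2 / (real n * (real n * fact (n - 1)))"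
    by (simp add: power_divide power_mult_distrib power2_eq_square)
  \<comment> \<open>One factor n completes the factorial; the other stays in the
    denominator.\<close>
  also have "real n * fact (n - 1) = fact n" using n by (simp add: fact_reduce)
  also have "(2 ^ (n - 1))\<^sup>2 / (real n * fact n) \<le> (real n ^ 20 * \<beta> ^ (2 * n)) / fact n"
  proof -
    have "(2 ^ (n - 1))\<^sup>2 = (2::real) ^ (2 * (n - 1))" by (simp only: power_mult[symmetric] mult.commute)
    also have "\<dots> \<le> 2 ^ (2 * n)" by (intro power_increasing) auto
    \<comment> \<open>Here 2 \<le> 81/16 < \<beta>.\<close>
    also have "\<dots> \<le> \<beta> ^ (2 * n)" using assms by (intro power_mono) auto
    also have "\<dots> \<le> real n ^ 20 * \<beta> ^ (2 * n)"
      using n assms mult_right_mono[of 1 "real n ^ 20" "\<beta> ^ (2 * n)"] by simp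
    finally have le: "(2 ^ (n - 1))\<^sup>2 \<le> real n ^ 20 * \<beta> ^ (2 * n)" .
    have "(2 ^ (n - 1))\<^sup>2 / (real n * fact n) \<le> (2 ^ (n - 1))\<^sup>2 / fact n"
      using n by (intro divide_left_mono) auto
    also have "\<dots> \<le> (real n ^ 20 * \<beta> ^ (2 * n)) / fact n" using le by (intro divide_right_mono) auto
    finally show ?thesis .
  qed
  finally show "(cmod (sandwich (arcs n) (psi_cycles n) (op_pow (arcs n) (szegedy_walk n) t) (psi_id n)))\<^sup>2
      \<le> 1 * (real n ^ 20 * \<beta> ^ (2 * n) / fact n)" by simp
qed

end
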